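(* Let $\Gamma = (V,E,m)$ and $\Gamma' = (V,E',m')$ be a pair of quantized dual graded graphs on the same vertex set $V$ with common height function $h$ and differential coefficient $r$, i.e. $D_{\Gamma'}U_\Gamma - q\,U_\Gamma D_{\Gamma'} = r I$. Suppose there is a unique minimum $\emptyset \in V$, with $h(\emptyset) = 0$. Then for every $n \geq 0$, $$\sum_{v \in V:\; h(v) = n} f_\Gamma^v \, f_{\Gamma'}^v = r^n [n]_q!.$$
   Context: A graded graph $\Gamma = (V,E,m)$ is a directed graph with vertex set $V$, a height function $h: V \to \mathbb{N}$ such that $(v,w) \in E$ implies $h(w) = h(v)+1$, no multiple edges, and a weight $m(v,w) \in \mathbb{N}[q]$ (a nonzero polynomial with nonnegative integer coefficients) on each edge; it is locally finite (each vertex has finitely many incoming and outgoing edges). On the $\mathbb{C}(q)$-vector space of formal (possibly infinite) linear combinations of $V$, define continuous linear operators $U_\Gamma(v) = \sum_{w:(v,w)\in E} m(v,w)\, w$ and $D_\Gamma(w) = \sum_{v:(v,w)\in E} m(v,w)\, v$. A pair $(\Gamma, \Gamma')$ of graded graphs with the same vertex set and height function is a pair of quantized dual graded graphs with differential coefficient $r \in \{1,2,3,\ldots\}$ if $D_{\Gamma'}U_\Gamma - q\,U_\Gamma D_{\Gamma'} = rI$. "Unique minimum $\emptyset$" means $\emptyset$ is the unique vertex with no incoming edges. For a vertex $v$ of height $n$, $f_\Gamma^v \in \mathbb{N}[q]$ is the coefficient of $v$ in $U_\Gamma^n(\emptyset)$, i.e. the sum over all directed paths $\emptyset = v_0 \to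 v_1 \to \cdots \to v_n = v$ in $\Gamma$ of $\prod_i m(v_{i-1},v_i)$; similarly $f_{\Gamma'}^v$ using $\Gamma'$. $[n]_q = 1+q+\cdots+q^{n-1}$ and $[n]_q! = [n]_q[n-1]_q\cdots[1]_q$ (with $[0]_q! = 1$). *)

theory Defs
  imports Complex_Main "HOL-Computational_Algebra.Computational_Algebra"
begin

section \<open>The field of rational functions in \<open>q\<close>\<close>

type_synonym ratfun = "complex poly fract"

definition qvar :: ratfun where
  "qvar = to_fract [:0, 1:]"

definition natpoly_to_ratfun :: "nat poly \<Rightarrow> ratfun" where
  "natpoly_to_ratfun p = to_fract (map_poly of_nat p)"

definition q_int :: "nat \<Rightarrow> ratfun" where
  "q_int n = (\<Sum>k<n. qvar ^ k)"

definition q_fact :: "nat \<Rightarrow> ratfun" where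
  "q_fact n = (\<Prod>k = 1..n. q_int k)"


section \<open>Graded graphs\<close>

text \<open>
  The edge set is a relation, so there are no multiple edges. The weight \<open>m v w\<close> is only
  meaningful on edges; its values elsewhere are never used.
\<close>

locale graded_graph =
  fixes V :: "'v set" and h :: "'v \<Rightarrow> nat"
    and E :: "('v \<times> 'v) set" and m :: "'v \<Rightarrow> 'v \<Rightarrow> nat poly"
  assumes edges_subset: "E \<subseteq> V \<times> V"
    and height_edge: "(v, w) \<in> E \<Longrightarrow> h w = h v + 1"
    and weight_nonzero: "(v, w) \<in> E \<Longrightarrow> m v w \<noteq> 0"
    and finite_outgoing: "v \<in> V \<Longrightarrow> finite {w. (v, w) \<in> E}"
    and finite_incoming: "w \<in> V \<Longrightarrow> finite {v. (v, w) \<in> E}"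

text \<open>
  A formal, possibly infinite, linear combination of the vertices is its family of coefficients,
  extended by zero outside \<open>V\<close>.
\<close>

definition formal_combinations :: "'v set \<Rightarrow> ('v \<Rightarrow> ratfun) set" where
  "formal_combinations V = {x. \<forall>v. v \<notin> V \<longrightarrow> x v = 0}"

definition vertex_vec :: "'v \<Rightarrow> 'v \<Rightarrow> ratfun" where
  "vertex_vec v = (\<lambda>w. if w = v then 1 else 0)"

text \<open>
  The continuous linear extensions of \<open>U(v) = \<Sum>w. m(v,w) w\<close> and \<open>D(w) = \<Sum>v. m(v,w) v\<close>, written
  by coefficients: the coefficient of \<open>w\<close> in \<open>U(x)\<close> collects the contributions of the
  edges entering \<open>w\<close>, that of \<open>v\<close> in \<open>D(x)\<close> those of the edges leaving \<open>v\<close>.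
  Both sums are finite by local finiteness.
\<close>

definition up_op :: "('v \<times> 'v) set \<Rightarrow> ('v \<Rightarrow> 'v \<Rightarrow> nat poly) \<Rightarrow> ('v \<Rightarrow> ratfun) \<Rightarrow> ('v \<Rightarrow> ratfun)" where
  "up_op E m x = (\<lambda>w. \<Sum>v \<in> {v. (v, w) \<in> E}. natpoly_to_ratfun (m v w) * x v)"

definition down_op :: "('v \<times> 'v) set \<Rightarrow> ('v \<Rightarrow> 'v \<Rightarrow> nat poly) \<Rightarrow> ('v \<Rightarrow> ratfun) \<Rightarrow> ('v \<Rightarrow> ratfun)" where
  "down_op E m x = (\<lambda>v. \<Sum>w \<in> {w. (v, w) \<in> E}. natpoly_to_ratfun (m v w) * x w)"

locale quantized_dual_graded_graphs =
  G: graded_graph V h E m + G': graded_graph V h E' m'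
  for V :: "'v set" and h :: "'v \<Rightarrow> nat"
    and E :: "('v \<times> 'v) set" and m :: "'v \<Rightarrow> 'v \<Rightarrow> nat poly"
    and E' :: "('v \<times> 'v) set" and m' :: "'v \<Rightarrow> 'v \<Rightarrow> nat poly" +
  fixes r :: nat
  assumes differential_coeff_pos: "r \<ge> 1"
    and commutation: "x \<in> formal_combinations V \<Longrightarrow>
      down_op E' m' (up_op E m x) v - qvar * up_op E m (down_op E' m' x) v = of_nat r * x v"

text \<open>
  For a pair of graphs on the same vertices this is used with the union of the two edge sets.
  When \<open>z\<close> has height zero, that condition follows from \<open>z\<close> being the unique vertex without incoming
  edges in one of the two graphs, see \<open>unique_minimum_if_fst\<close> and \<open>unique_minimum_if_snd\<close> below.
\<close>

definition unique_minimum :: "'v set \<Rightarrow> ('v \<times> 'v) set \<Rightarrow> 'v \<Rightarrow> bool" where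
  "unique_minimum V E z \<longleftrightarrow> z \<in> V \<and> (\<forall>v\<in>V. (\<nexists>u. (u, v) \<in> E) \<longleftrightarrow> v = z)"

definition f_coeff :: "('v \<Rightarrow> nat) \<Rightarrow> ('v \<times> 'v) set \<Rightarrow> ('v \<Rightarrow> 'v \<Rightarrow> nat poly) \<Rightarrow> 'v \<Rightarrow> 'v \<Rightarrow> ratfun" where
  "f_coeff h E m z v = (up_op E m ^^ h v) (vertex_vec z) v"


section \<open>Basic facts\<close>

lemma map_poly_of_nat_add:
  "map_poly of_nat (p + q) = (map_poly of_nat p + map_poly of_nat q :: complex poly)"
  by (rule poly_eqI) (simp add: coeff_map_poly)

lemma map_poly_of_nat_mult:
  "map_poly of_nat (p * q) = (map_poly of_nat p * map_poly of_nat q :: complex poly)"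
  by (rule poly_eqI) (simp add: coeff_map_poly coeff_mult)

lemma natpoly_to_ratfun_0 [simp]: "natpoly_to_ratfun 0 = 0"
  and natpoly_to_ratfun_1 [simp]: "natpoly_to_ratfun 1 = 1"
  and natpoly_to_ratfun_add: "natpoly_to_ratfun (p + s) = natpoly_to_ratfun p + natpoly_to_ratfun s"
  and natpoly_to_ratfun_mult: "natpoly_to_ratfun (p * s) = natpoly_to_ratfun p * natpoly_to_ratfun s"
  by (simp_all add: natpoly_to_ratfun_def map_poly_of_nat_add map_poly_of_nat_mult)

lemma natpoly_to_ratfun_sum: "natpoly_to_ratfun (sum g A) = (\<Sum>x\<in>A. natpoly_to_ratfun (g x))"
  by (induction A rule: infinite_finite_induct) (simp_all add: natpoly_to_ratfun_add)

lemma inj_natpoly_to_ratfun: "inj natpoly_to_ratfun"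
proof (rule injI)
  fix p s assume "natpoly_to_ratfun p = natpoly_to_ratfun s"
  hence "map_poly of_nat p = (map_poly of_nat s :: complex poly)"
    by (simp add: natpoly_to_ratfun_def)
  hence "(of_nat (coeff p i) :: complex) = of_nat (coeff s i)" for i
    by (metis coeff_map_poly of_nat_0)
  thus "p = s" by (intro poly_eqI) simp
qed

lemma (in graded_graph) up_op_vertex_vec:
  assumes "v \<in> V"
  shows "up_op E m (vertex_vec v) w = (if (v, w) \<in> E then natpoly_to_ratfun (m v w) else 0)"
proof (cases "w \<in> V")
  case True
  have "up_op E m (vertex_vec v) w
      = (\<Sum>u \<in> {u. (u, w) \<in> E}. if u = v then natpoly_to_ratfun (m v w) else 0)"
    unfolding up_op_def vertex_vec_def by (rule sum.cong) auto
  with finite_incoming[OF True] show ?thesis by (simp add: sum.delta)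
next
  case False
  hence "{u. (u, w) \<in> E} = {}" using edges_subset by auto
  thus ?thesis by (auto simp: up_op_def)
qed

lemma (in graded_graph) down_op_vertex_vec:
  assumes "w \<in> V"
  shows "down_op E m (vertex_vec w) v = (if (v, w) \<in> E then natpoly_to_ratfun (m v w) else 0)"
proof (cases "v \<in> V")
  case True
  have "down_op E m (vertex_vec w) v
      = (\<Sum>u \<in> {u. (v, u) \<in> E}. if u = w then natpoly_to_ratfun (m v w) else 0)"
    unfolding down_op_def vertex_vec_def by (rule sum.cong) auto
  with finite_outgoing[OF True] show ?thesis by (simp add: sum.delta)
next
  case False
  hence "{u. (v, u) \<in> E} = {}" using edges_subset by auto
  thus ?thesis by (auto simp: down_op_def)
qed

text \<open>The coefficients of \<open>U\<^sup>n(z)\<close> are weighted path counts and hence lie in \<open>\<nat>[q]\<close>.\<close>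

definition dpaths :: "('v \<times> 'v) set \<Rightarrow> 'v \<Rightarrow> nat \<Rightarrow> 'v \<Rightarrow> 'v list set" where
  "dpaths E z n v = {p. length p = Suc n \<and> p ! 0 = z \<and> p ! n = v \<and> (\<forall>i<n. (p ! i, p ! Suc i) \<in> E)}"

definition path_weight :: "('v \<Rightarrow> 'v \<Rightarrow> nat poly) \<Rightarrow> 'v list \<Rightarrow> nat poly" where
  "path_weight m p = (\<Prod>i<length p - 1. m (p ! i) (p ! Suc i))"

lemma dpaths_0: "dpaths E z 0 v = (if v = z then {[z]} else {})"
  by (auto simp: dpaths_def length_Suc_conv)

lemma dpaths_Suc: "dpaths E z (Suc n) w = (\<Union>v\<in>{v. (v, w) \<in> E}. (\<lambda>p. p @ [w]) ` dpaths E z n v)"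
proof (intro equalityI subsetI)
  fix p assume p: "p \<in> dpaths E z (Suc n) w"
  hence len: "length p = Suc (Suc n)" by (simp add: dpaths_def)
  then obtain p' a where p': "p = p' @ [a]" by (metis length_Suc_conv_rev)
  have len': "length p' = Suc n" using len p' by simp
  have "a = w" using p p' len' by (simp add: dpaths_def nth_append)
  moreover have edge: "(p ! i, p ! Suc i) \<in> E" if "i < Suc n" for i
    using p that by (simp add: dpaths_def)
  have "(p' ! n, w) \<in> E" using edge[of n] \<open>a = w\<close> p' len' by (simp add: nth_append)
  moreover have "(p' ! i, p' ! Suc i) \<in> E" if "i < n" for i
    using edge[of i] that p' len' by (simp add: nth_append)
  moreover have "p' ! 0 = z" using p p' len' by (simp add: dpaths_def nth_append)
  ultimately show "p \<in> (\<Union>v\<in>{v. (v, w) \<in> E}. (\<lambda>p. p @ [w]) ` dpaths E z n v)"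
    using p' len' by (auto simp: dpaths_def)
next
  fix p assume "p \<in> (\<Union>v\<in>{v. (v, w) \<in> E}. (\<lambda>p. p @ [w]) ` dpaths E z n v)"
  then obtain v p' where "(v, w) \<in> E" "p' \<in> dpaths E z n v" "p = p' @ [w]" by auto
  thus "p \<in> dpaths E z (Suc n) w"
    by (auto simp: dpaths_def nth_append less_Suc_eq)
qed

lemma path_weight_snoc:
  assumes "p \<in> dpaths E z n v"
  shows "path_weight m (p @ [w]) = path_weight m p * m v w"
proof -
  have "length p = Suc n" "p ! n = v" using assms by (simp_all add: dpaths_def)
  thus ?thesis by (simp add: path_weight_def nth_append)
qed

lemma (in graded_graph) finite_dpaths: "finite (dpaths E z n v)"
proof (induction n arbitrary: v)
  case 0
  show ?case by (simp add: dpaths_0)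
next
  case (Suc n)
  have "finite {u. (u, v) \<in> E}"
  proof (cases "v \<in> V")
    case False
    hence "{u. (u, v) \<in> E} = {}" using edges_subset by auto
    thus ?thesis by simp
  qed (rule finite_incoming)
  thus ?case using Suc by (simp add: dpaths_Suc)
qed

lemma (in graded_graph) up_op_power_eq_paths:
  "(up_op E m ^^ n) (vertex_vec z) v = natpoly_to_ratfun (\<Sum>p \<in> dpaths E z n v. path_weight m p)"
proof (induction n arbitrary: v)
  case 0
  show ?case by (simp add: dpaths_0 vertex_vec_def path_weight_def)
next
  case (Suc n)
  have fin: "finite {u. (u, v) \<in> E}"
  proof (cases "v \<in> V")
    case False
    hence "{u. (u, v) \<in> E} = {}" using edges_subset by auto
    thus ?thesis by simp
  qed (rule finite_incoming)
  have disj: "(\<lambda>p. p @ [v]) ` dpaths E z n u \<inter> (\<lambda>p. p @ [v]) ` dpaths E z n u' = {}"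
    if "u \<noteq> u'" for u u'
    using that by (auto simp: dpaths_def)
  have "(\<Sum>p \<in> dpaths E z (Suc n) v. path_weight m p)
      = (\<Sum>u \<in> {u. (u, v) \<in> E}. \<Sum>p \<in> (\<lambda>p. p @ [v]) ` dpaths E z n u. path_weight m p)"
    unfolding dpaths_Suc
    by (rule sum.UNION_disjoint) (use fin disj in \<open>auto simp: finite_dpaths\<close>)
  also have "\<dots> = (\<Sum>u \<in> {u. (u, v) \<in> E}. m u v * (\<Sum>p \<in> dpaths E z n u. path_weight m p))"
  proof (rule sum.cong[OF refl])
    fix u
    have "(\<Sum>p \<in> (\<lambda>p. p @ [v]) ` dpaths E z n u. path_weight m p)
        = (\<Sum>p \<in> dpaths E z n u. path_weight m (p @ [v]))"
      by (subst sum.reindex) (auto simp: inj_on_def)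
    also have "\<dots> = (\<Sum>p \<in> dpaths E z n u. m u v * path_weight m p)"
      by (rule sum.cong) (auto simp: path_weight_snoc mult.commute)
    finally show "(\<Sum>p \<in> (\<lambda>p. p @ [v]) ` dpaths E z n u. path_weight m p)
        = m u v * (\<Sum>p \<in> dpaths E z n u. path_weight m p)"
      by (simp add: sum_distrib_left)
  qed
  finally have "natpoly_to_ratfun (\<Sum>p \<in> dpaths E z (Suc n) v. path_weight m p)
     = (\<Sum>u \<in> {u. (u, v) \<in> E}. natpoly_to_ratfun (m u v) * (up_op E m ^^ n) (vertex_vec z) u)"
    by (simp add: Suc natpoly_to_ratfun_sum[where A = "{u. (u, v) \<in> E}"] natpoly_to_ratfun_mult)
  thus ?case by (simp add: up_op_def[of E m "(up_op E m ^^ n) (vertex_vec z)"])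
qed

lemma (in graded_graph) f_coeff_eq_paths:
  "f_coeff h E m z v = natpoly_to_ratfun (\<Sum>p \<in> dpaths E z (h v) v. path_weight m p)"
  by (simp add: f_coeff_def up_op_power_eq_paths)

context quantized_dual_graded_graphs
begin

lemma unique_minimum_if_fst:
  assumes "unique_minimum V E z" "h z = 0"
  shows "unique_minimum V (E \<union> E') z"
  using assms G'.height_edge[of _ z] unfolding unique_minimum_def by fastforce

lemma unique_minimum_if_snd:
  assumes "unique_minimum V E' z" "h z = 0"
  shows "unique_minimum V (E \<union> E') z"
  using assms G.height_edge[of _ z] unfolding unique_minimum_def by fastforce

text \<open>In particular, sums over a level are genuinely finite sums.\<close>

lemma finite_level:
  assumes "unique_minimum V (E \<union> E') z" "h z = 0"
  shows "finite {v \<in> V. h v = n}"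
proof (induction n)
  case 0
  have "v = z" if "v \<in> V" "h v = 0" for v
    using assms that G.height_edge[of _ v] G'.height_edge[of _ v]
    unfolding unique_minimum_def by fastforce
  hence "{v \<in> V. h v = 0} \<subseteq> {z}" by auto
  thus ?case by (rule finite_subset) simp
next
  case (Suc n)
  have "{v \<in> V. h v = Suc n}
      \<subseteq> (\<Union>u \<in> {v \<in> V. h v = n}. {w. (u, w) \<in> E} \<union> {w. (u, w) \<in> E'})"
  proof
    fix v assume v: "v \<in> {v \<in> V. h v = Suc n}"
    hence "v \<noteq> z" using assms(2) by auto
    then obtain u where u: "(u, v) \<in> E \<union> E'" using v assms(1) unfolding unique_minimum_def by blast
    hence "u \<in> V" "h u = n"
      using v G.edges_subset G'.edges_subset G.height_edge[of u v] G'.height_edge[of u v] by auto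
    thus "v \<in> (\<Union>u \<in> {v \<in> V. h v = n}. {w. (u, w) \<in> E} \<union> {w. (u, w) \<in> E'})"
      using u by auto
  qed
  thus ?case
    by (rule finite_subset) (use Suc G.finite_outgoing G'.finite_outgoing in auto)
qed

end

end

theory Submission
  imports Defs
begin

text \<open>
  Since \<open>D(z) = 0\<close>, the commutation relation gives \<open>D (U\<^sup>n\<^sup>+\<^sup>1 z) = r [n+1]\<^sub>q U\<^sup>n z\<close>. On the other hand,
  \<open>D\<close> for \<open>\<Gamma>'\<close> is adjoint to \<open>U'\<close> for \<open>\<Gamma>'\<close> under the pairing in which the vertices are
  orthonormal, so moving one \<open>U'\<close> across the pairing of \<open>U\<^sup>n\<^sup>+\<^sup>1 z\<close> with \<open>U'\<^sup>n\<^sup>+\<^sup>1 z\<close> lowers the level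
  by one at the cost of the factor \<open>r [n+1]\<^sub>q\<close>.
\<close>

text \<open>The constant term is split off, not the top power, to match the shape
  \<open>D U = r + q U D\<close>.\<close>

lemma q_int_Suc: "q_int (Suc n) = 1 + qvar * q_int n"
  unfolding q_int_def by (simp add: sum.lessThan_Suc_shift sum_distrib_left del: sum.lessThan_Suc)

lemma q_fact_Suc: "q_fact (Suc n) = q_int (Suc n) * q_fact n"
  by (simp add: q_fact_def mult.commute)

lemma up_op_scale: "up_op E m (\<lambda>v. c * x v) w = c * up_op E m x w"
  by (simp add: up_op_def sum_distrib_left mult.left_commute)

context graded_graph
begin

text \<open>Edges end in \<open>V\<close>, so the defining sum is empty elsewhere. This allows
  \<open>commutation\<close> to be applied to iterates of \<open>up_op\<close>.\<close>

lemma up_op_formal_combination: "up_op E m x \<in> formal_combinations V"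
proof -
  have "{u. (u, w) \<in> E} = {}" if "w \<notin> V" for w
    using that edges_subset by auto
  thus ?thesis by (simp add: formal_combinations_def up_op_def)
qed

lemma down_op_vertex_vec_height_0:
  assumes "z \<in> V" "h z = 0"
  shows "down_op E m (vertex_vec z) v = 0"
  using assms height_edge[of v z] by (auto simp: down_op_vertex_vec)

text \<open>Both sides sum over the edges between two consecutive levels, grouped by upper and by
  lower endpoint respectively.\<close>

lemma up_op_down_op_adjoint:
  assumes fin: "finite {v \<in> V. h v = n}" "finite {w \<in> V. h w = Suc n}"
  shows "(\<Sum>w | w \<in> V \<and> h w = Suc n. x w * up_op E m y w)
       = (\<Sum>v | v \<in> V \<and> h v = n. down_op E m x v * y v)"
proof -
  \<comment> \<open>Neighbourhoods become restrictions of a fixed finite level, as the exchange of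
    sums requires.\<close>
  have into: "{v. (v, w) \<in> E} = {v \<in> {v \<in> V. h v = n}. (v, w) \<in> E}" if "h w = Suc n" for w
    using that edges_subset height_edge[of _ w] by auto
  have out: "{w. (v, w) \<in> E} = {w \<in> {w \<in> V. h w = Suc n}. (v, w) \<in> E}" if "h v = n" for v
    using that edges_subset height_edge[of v] by auto
  have "(\<Sum>w | w \<in> V \<and> h w = Suc n. x w * up_op E m y w)
      = (\<Sum>w | w \<in> V \<and> h w = Suc n. \<Sum>v | v \<in> {v \<in> V. h v = n} \<and> (v, w) \<in> E.
           natpoly_to_ratfun (m v w) * x w * y v)"
    by (intro sum.cong refl)
       (simp add: up_op_def into sum_distrib_left mult_ac)
  also have "\<dots> = (\<Sum>v | v \<in> V \<and> h v = n. \<Sum>w | w \<in> {w \<in> V. h w = Suc n} \<and> (v, w) \<in> E.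
           natpoly_to_ratfun (m v w) * x w * y v)"
    by (rule sum.swap_restrict[OF fin(2,1)])
  also have "\<dots> = (\<Sum>v | v \<in> V \<and> h v = n. down_op E m x v * y v)"
    by (intro sum.cong refl)
       (simp add: down_op_def out sum_distrib_right)
  finally show ?thesis .
qed

end

context quantized_dual_graded_graphs
begin

lemma down_op_up_op_power:
  assumes z: "z \<in> V" "h z = 0"
  shows "down_op E' m' ((up_op E m ^^ Suc n) (vertex_vec z))
       = (\<lambda>v. of_nat r * q_int (Suc n) * (up_op E m ^^ n) (vertex_vec z) v)"
proof (induction n)
  case 0
  have "vertex_vec z \<in> formal_combinations V"
    using z by (auto simp: formal_combinations_def vertex_vec_def)
  \<comment> \<open>The \<open>q\<close>-term vanishes, leaving \<open>r\<close>, which is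
    \<open>r\<close> times \<open>q_int 1\<close>.\<close>
  moreover have "up_op E m (down_op E' m' (vertex_vec z)) v = 0" for v
    using z by (simp add: up_op_def G'.down_op_vertex_vec_height_0)
  ultimately show ?case
    using commutation[of "vertex_vec z"] by (auto simp: q_int_def fun_eq_iff)
next
  case (Suc n)
  define x where "x = (up_op E m ^^ Suc n) (vertex_vec z)"
  have x: "x = up_op E m ((up_op E m ^^ n) (vertex_vec z))" by (simp add: x_def)
  show ?case
  proof
    fix v
    have "down_op E' m' x = (\<lambda>v. of_nat r * q_int (Suc n) * (up_op E m ^^ n) (vertex_vec z) v)"
      using Suc x_def by simp
    \<comment> \<open>By linearity the scalar leaves \<open>up_op\<close>, and what remains is
      \<open>x\<close> again. Hence \<open>commutation\<close> yields the factor
      \<open>r (1 + q [n+1])\<close>.\<close>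
    hence "up_op E m (down_op E' m' x) v = of_nat r * q_int (Suc n) * x v"
      using x by (simp only: up_op_scale)
    moreover have "down_op E' m' (up_op E m x) v - qvar * up_op E m (down_op E' m' x) v
        = of_nat r * x v"
      unfolding x by (rule commutation) (rule G.up_op_formal_combination)
    ultimately have "down_op E' m' (up_op E m x) v = of_nat r * q_int (Suc (Suc n)) * x v"
      by (simp add: q_int_Suc[of "Suc n"] algebra_simps)
    thus "down_op E' m' ((up_op E m ^^ Suc (Suc n)) (vertex_vec z)) v
        = of_nat r * q_int (Suc (Suc n)) * (up_op E m ^^ Suc n) (vertex_vec z) v"
      by (simp add: x_def)
  qed
qed

text \<open>An edge of either graph ends at positive height, so a vertex of height zero has no
  incoming edge.\<close>

lemma level_0_eq:
  assumes "unique_minimum V (E \<union> E') z" "h z = 0"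
  shows "{v \<in> V. h v = 0} = {z}"
  using assms G.height_edge G'.height_edge unfolding unique_minimum_def by fastforce

text \<open>The exponent is \<open>n\<close> instead of the \<open>h v\<close> of
  \<open>f_coeff\<close>, so that induction can peel off one operator.\<close>

lemma sum_level_up_op_powers:
  assumes z: "unique_minimum V (E \<union> E') z" "h z = 0"
  shows "(\<Sum>v | v \<in> V \<and> h v = n.
           (up_op E m ^^ n) (vertex_vec z) v * (up_op E' m' ^^ n) (vertex_vec z) v)
       = of_nat r ^ n * q_fact n"
proof (induction n)
  case 0
  show ?case using level_0_eq[OF z] by (simp add: vertex_vec_def q_fact_def)
next
  case (Suc n)
  have "z \<in> V" using z by (simp add: unique_minimum_def)
  have "(\<Sum>v | v \<in> V \<and> h v = Suc n.
          (up_op E m ^^ Suc n) (vertex_vec z) v * (up_op E' m' ^^ Suc n) (vertex_vec z) v)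
      = (\<Sum>v | v \<in> V \<and> h v = n.
          down_op E' m' ((up_op E m ^^ Suc n) (vertex_vec z)) v * (up_op E' m' ^^ n) (vertex_vec z) v)"
    \<comment> \<open>Only the outermost \<open>up_op E' m'\<close> is moved across; the iterate of
      \<open>up_op E m\<close> serves as \<open>x\<close>.\<close>
    using G'.up_op_down_op_adjoint[OF finite_level[OF z] finite_level[OF z]] by simp
  also have "\<dots> = of_nat r * q_int (Suc n) * (\<Sum>v | v \<in> V \<and> h v = n.
          (up_op E m ^^ n) (vertex_vec z) v * (up_op E' m' ^^ n) (vertex_vec z) v)"
    unfolding down_op_up_op_power[OF \<open>z \<in> V\<close> z(2)] by (simp add: sum_distrib_left mult.assoc)
  finally show ?case
    unfolding Suc by (simp add: q_fact_Suc mult_ac)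
qed

end

theorem theorem2:
  fixes V :: "'v set" and h :: "'v \<Rightarrow> nat"
    and E E' :: "('v \<times> 'v) set" and m m' :: "'v \<Rightarrow> 'v \<Rightarrow> nat poly"
    and r n :: nat and z :: 'v
  assumes "quantized_dual_graded_graphs V h E m E' m' r"
    and "unique_minimum V (E \<union> E') z"
    and "h z = 0"
  shows "(\<Sum>v \<in> {v \<in> V. h v = n}. f_coeff h E m z v * f_coeff h E' m' z v) = of_nat r ^ n * q_fact n"
proof -
  interpret quantized_dual_graded_graphs V h E m E' m' r by fact
  have "(\<Sum>v \<in> {v \<in> V. h v = n}. f_coeff h E m z v * f_coeff h E' m' z v)
      = (\<Sum>v | v \<in> V \<and> h v = n.
          (up_op E m ^^ n) (vertex_vec z) v * (up_op E' m' ^^ n) (vertex_vec z) v)"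
    by (rule sum.cong) (auto simp: f_coeff_def)
  also have "\<dots> = of_nat r ^ n * q_fact n"
    using assms(2,3) by (rule sum_level_up_op_powers)
  finally show ?thesis .
qed

end
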